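(* In the discrete-time Stackelberg games described in the context, the two firms repeat the duopoly game $N$ times. Let the leader (firm-0) defect with $\hat u_0$ from the $m$-th game, and let the third party use the discount factor $$\rho(n)=\begin{cases}1, & 1\le n\le m-1,\\ \rho(n-1)-k\,\Delta J_0(n-1), & m\le n\le N.\end{cases}$$ Then there exists a constant $k>0$ satisfying $$(1-k\Delta J_{0}(1))^{N-m+1}\geq 1-\frac{8}{9}\,k\,\Delta J_{0}(1)\,(N-m+1),$$ such that the payoff after defection must be less than the payoff with the Stackelberg equilibrium strategy, that is, $$\sum_{n=1}^N\tilde{J}_0(n)\leq N J^*_0(1).$$ Thus firm-0 will keep the Stackelberg equilibrium during the entire game.
   Context: One-shot game. Two firms, firm-0 (leader) and firm-1 (follower), produce a homogeneous good with outputs $u_0,u_1$, chosen from admissible classes $\mathcal U_0,\mathcal U_1$. The inverse demand function is $K=a-b(u_1+u_0)$ with constants $a,b>0$; the unit costs satisfy $c_0\le c_1$. The knowledge stocks $x_i\in[0,1]$ satisfy $\dot x_0(t)=0$ with initial stock $x_0(0)$, and $\dot x_1(t)=u_1(t)-\delta x_1(t)$, $x_1(0)=0$, $\delta>0$. The leader maximizes $J_0=u_0(a-b(u_1+u_0)-c_0)$ and the follower maximizes $J_1=u_1(a-b(u_1+u_0)-c_1)$. The leader announces his output first, taking into account the follower's best reply. The Stackelberg equilibrium is $(u_0^*,u_1^* )=\big(\frac{a+c_1-2c_0}{2b},\frac{a+2c_0-3c_1}{4b}\big)$, with leader's payoff $\frac{(a+c_1-2c_0)^2}{8b}$. The leader's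 defection strategy is his best reply to $u_1^*$, namely $\hat u_0=\frac{3(a+c_1-2c_0)}{8b}$; with the follower still playing $u_1^*$ it gives the leader the payoff $\frac{9(a+c_1-2c_0)^2}{64b}$. Repeated game. The same one-shot game is played $N$ times (during $[0,T]$, each firm moving once at the beginning of each period). Denote by $J_0^*(n)$ the payoff of firm-0 with strategy $u_0^*$ in the $n$-th game, by $\hat J_0(n)$ its payoff with the defection strategy $\hat u_0$ in the $n$-th game, and by $\Delta J_0(n):=\hat J_0(n)-J_0^*(n)$ the extra payoff of $\hat u_0$ over $u_0^*$ in the $n$-th game. In particular $\Delta J_0(1)=\frac{(a+c_1-2c_0)^2}{64b}$, which is positive. If the leader defects with $\hat u_0$ from the $m$-th game, a third party discounts his payoff: the actual payoff of firm-0 in the $n$-th game is $$\tilde J_0(n)=\rho(n)\big(-bu_0^2+(a-bu_1-c_0)u_0\big),$$ where $u_0,u_1$ are the outputs in that game and $\rho$ is the discount factor stated in the claim, whose parameter satisfies $k\in\big(0,(\Delta J_0(1))^{-1}\big)$.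
   Formalization: The formal theorem assumes m < N: for m = N the condition on k reads 1 − kΔJ₀(1) ≥ 1 − (8/9)kΔJ₀(1), which no k > 0 satisfies since ΔJ₀(1) > 0, so the claim fails there. *)

theory Defs
  imports Complex_Main
begin

definition J0 :: "real \<Rightarrow> real \<Rightarrow> real \<Rightarrow> real \<Rightarrow> real \<Rightarrow> real" where
  "J0 a b c0 u0 u1 = u0 * (a - b * (u1 + u0) - c0)"

definition J1 :: "real \<Rightarrow> real \<Rightarrow> real \<Rightarrow> real \<Rightarrow> real \<Rightarrow> real" where
  "J1 a b c1 u0 u1 = u1 * (a - b * (u1 + u0) - c1)"

definition leader_best_reply ::
    "real \<Rightarrow> real \<Rightarrow> real \<Rightarrow> real set \<Rightarrow> real \<Rightarrow> real \<Rightarrow> bool" where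
  "leader_best_reply a b c0 U0 u1 u0 \<longleftrightarrow>
     is_arg_max (\<lambda>v. J0 a b c0 v u1) (\<lambda>v. v \<in> U0) u0"

definition follower_best_reply ::
    "real \<Rightarrow> real \<Rightarrow> real \<Rightarrow> real set \<Rightarrow> real \<Rightarrow> real \<Rightarrow> bool" where
  "follower_best_reply a b c1 U1 u0 u1 \<longleftrightarrow>
     is_arg_max (\<lambda>v. J1 a b c1 u0 v) (\<lambda>v. v \<in> U1) u1"

text \<open>\<open>R\<close> is the follower's strategy: a best reply to every announcement the leader could make,
  not only to the equilibrium one.\<close>

definition stackelberg_equilibrium ::
    "real \<Rightarrow> real \<Rightarrow> real \<Rightarrow> real \<Rightarrow> real set \<Rightarrow> real set \<Rightarrow> real \<Rightarrow> real \<Rightarrow> bool" where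
  "stackelberg_equilibrium a b c0 c1 U0 U1 u0 u1 \<longleftrightarrow>
     (\<exists>R. (\<forall>v\<in>U0. follower_best_reply a b c1 U1 v (R v)) \<and> u1 = R u0 \<and>
          is_arg_max (\<lambda>v. J0 a b c0 v (R v)) (\<lambda>v. v \<in> U0) u0)"

definition u0_star :: "real \<Rightarrow> real \<Rightarrow> real \<Rightarrow> real \<Rightarrow> real" where
  "u0_star a b c0 c1 = (a + c1 - 2 * c0) / (2 * b)"

definition u1_star :: "real \<Rightarrow> real \<Rightarrow> real \<Rightarrow> real \<Rightarrow> real" where
  "u1_star a b c0 c1 = (a + 2 * c0 - 3 * c1) / (4 * b)"

definition u0_hat :: "real \<Rightarrow> real \<Rightarrow> real \<Rightarrow> real \<Rightarrow> real" where
  "u0_hat a b c0 c1 = 3 * (a + c1 - 2 * c0) / (8 * b)"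

text \<open>Leader's payoffs in a game that is not discounted, in particular in the first game:
  \<open>J\<^sub>0\<^sup>*(1)\<close>, the payoff of the defection strategy, and \<open>\<Delta>J\<^sub>0(1)\<close>.\<close>

definition first_J0_star :: "real \<Rightarrow> real \<Rightarrow> real \<Rightarrow> real \<Rightarrow> real" where
  "first_J0_star a b c0 c1 = J0 a b c0 (u0_star a b c0 c1) (u1_star a b c0 c1)"

definition first_J0_hat :: "real \<Rightarrow> real \<Rightarrow> real \<Rightarrow> real \<Rightarrow> real" where
  "first_J0_hat a b c0 c1 = J0 a b c0 (u0_hat a b c0 c1) (u1_star a b c0 c1)"

definition first_dJ0 :: "real \<Rightarrow> real \<Rightarrow> real \<Rightarrow> real \<Rightarrow> real" where
  "first_dJ0 a b c0 c1 = first_J0_hat a b c0 c1 - first_J0_star a b c0 c1"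

text \<open>The payoffs in the \<open>n\<close>-th game carry the discount factor \<open>\<rho>(n)\<close>, so \<open>\<rho>\<close> and
  \<open>\<Delta>J\<^sub>0\<close> are defined by simultaneous recursion. The payoffs are inlined in the recursion below;
  \<open>rho_rec\<close> states it in the form \<open>\<rho>(n) = \<rho>(n-1) - k \<Delta>J\<^sub>0(n-1)\<close>. The value \<open>\<rho>(0) = 1\<close> matters
  only for \<open>m = 1\<close>, where the recursion refers to the time before the first game.\<close>

fun rho :: "real \<Rightarrow> real \<Rightarrow> real \<Rightarrow> real \<Rightarrow> real \<Rightarrow> nat \<Rightarrow> nat \<Rightarrow> real" where
  "rho a b c0 c1 k m 0 = 1"
| "rho a b c0 c1 k m (Suc n) =
     (if Suc n < m then 1
      else rho a b c0 c1 k m n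
           - k * (rho a b c0 c1 k m n * first_J0_hat a b c0 c1
                  - rho a b c0 c1 k m n * first_J0_star a b c0 c1))"

definition J0_star :: "real \<Rightarrow> real \<Rightarrow> real \<Rightarrow> real \<Rightarrow> real \<Rightarrow> nat \<Rightarrow> nat \<Rightarrow> real" where
  "J0_star a b c0 c1 k m n = rho a b c0 c1 k m n * first_J0_star a b c0 c1"

definition J0_hat :: "real \<Rightarrow> real \<Rightarrow> real \<Rightarrow> real \<Rightarrow> real \<Rightarrow> nat \<Rightarrow> nat \<Rightarrow> real" where
  "J0_hat a b c0 c1 k m n = rho a b c0 c1 k m n * first_J0_hat a b c0 c1"

definition dJ0 :: "real \<Rightarrow> real \<Rightarrow> real \<Rightarrow> real \<Rightarrow> real \<Rightarrow> nat \<Rightarrow> nat \<Rightarrow> real" where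
  "dJ0 a b c0 c1 k m n = J0_hat a b c0 c1 k m n - J0_star a b c0 c1 k m n"

definition u0_played :: "real \<Rightarrow> real \<Rightarrow> real \<Rightarrow> real \<Rightarrow> nat \<Rightarrow> nat \<Rightarrow> real" where
  "u0_played a b c0 c1 m n = (if n < m then u0_star a b c0 c1 else u0_hat a b c0 c1)"

definition J0_tilde :: "real \<Rightarrow> real \<Rightarrow> real \<Rightarrow> real \<Rightarrow> real \<Rightarrow> nat \<Rightarrow> nat \<Rightarrow> real" where
  "J0_tilde a b c0 c1 k m n =
     rho a b c0 c1 k m n *
       (- b * (u0_played a b c0 c1 m n)\<^sup>2
        + (a - b * u1_star a b c0 c1 - c0) * u0_played a b c0 c1 m n)"

lemma rho_before: "n < m \<Longrightarrow> rho a b c0 c1 k m n = 1"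
  by (cases n) auto

lemma rho_rec:
  assumes "1 \<le> m" "m \<le> n"
  shows "rho a b c0 c1 k m n = rho a b c0 c1 k m (n - 1) - k * dJ0 a b c0 c1 k m (n - 1)"
  using assms by (cases n) (auto simp: dJ0_def J0_hat_def J0_star_def)

lemma first_game:
  assumes "2 \<le> m"
  shows "J0_star a b c0 c1 k m 1 = first_J0_star a b c0 c1"
    and "J0_hat a b c0 c1 k m 1 = first_J0_hat a b c0 c1"
    and "dJ0 a b c0 c1 k m 1 = first_dJ0 a b c0 c1"
  using assms rho_before[of 1 m]
  by (auto simp: J0_star_def J0_hat_def dJ0_def first_dJ0_def)

lemma first_payoffs:
  assumes "b > 0"
  shows "first_J0_star a b c0 c1 = (a + c1 - 2 * c0)\<^sup>2 / (8 * b)"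
    and "first_J0_hat a b c0 c1 = 9 * (a + c1 - 2 * c0)\<^sup>2 / (64 * b)"
    and "first_dJ0 a b c0 c1 = (a + c1 - 2 * c0)\<^sup>2 / (64 * b)"
  using assms
  unfolding first_dJ0_def first_J0_star_def first_J0_hat_def J0_def u0_star_def u1_star_def u0_hat_def
  by (simp_all add: field_simps power2_eq_square)

lemma leader_best_reply_u0_hat:
  assumes "b > 0" "u0_hat a b c0 c1 \<in> U0"
  shows "leader_best_reply a b c0 U0 (u1_star a b c0 c1) (u0_hat a b c0 c1)"
proof -
  have "J0 a b c0 v (u1_star a b c0 c1)
      = J0 a b c0 (u0_hat a b c0 c1) (u1_star a b c0 c1) - b * (v - u0_hat a b c0 c1)\<^sup>2" for v
    using assms(1) unfolding J0_def u1_star_def u0_hat_def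
    by (simp add: field_simps power2_eq_square)
  moreover have "0 \<le> b * (v - u0_hat a b c0 c1)\<^sup>2" for v
    using assms(1) by simp
  ultimately show ?thesis
    unfolding leader_best_reply_def is_arg_max_def using assms(2) by (smt (verit))
qed

text \<open>For nonnegative outputs the closed forms are the Stackelberg equilibrium as soon as
  \<open>u1_star\<close> is itself nonnegative. If the leader floods the market the follower's reply is
  to produce nothing, and \<open>c0 \<le> c1\<close> is what makes this unprofitable for the leader.\<close>

lemma stackelberg_equilibrium_nonneg:
  assumes b: "b > 0" and c: "c0 \<le> c1" and i: "3 * c1 \<le> a + 2 * c0"
  shows "stackelberg_equilibrium a b c0 c1 {0..} {0..} (u0_star a b c0 c1) (u1_star a b c0 c1)"
proof -
  define r where "r v = (a - c1 - b * v) / (2 * b)" for v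
  define R where "R v = max 0 (r v)" for v
  have br: "b * r v = (a - c1 - b * v) / 2" for v
    using b by (simp add: r_def)
  have J1_eq: "J1 a b c1 v w = b * (r v)\<^sup>2 - b * (w - r v)\<^sup>2" for v w
  proof -
    have "b * (r v)\<^sup>2 - b * (w - r v)\<^sup>2 = w * (2 * (b * r v) - b * w)"
      by (simp add: algebra_simps power2_eq_square)
    also have "\<dots> = J1 a b c1 v w"
      unfolding br J1_def by (simp add: field_simps)
    finally show ?thesis ..
  qed
  have F: "follower_best_reply a b c1 {0..} v (R v)" for v
  proof -
    have "J1 a b c1 v w \<le> J1 a b c1 v (R v)" if "w \<ge> 0" for w
    proof -
      have "\<bar>R v - r v\<bar> \<le> \<bar>w - r v\<bar>"
        using that unfolding R_def by linarith
      then have "(R v - r v)\<^sup>2 \<le> (w - r v)\<^sup>2"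
        by (simp add: abs_le_square_iff)
      then show ?thesis
        unfolding J1_eq using b by simp
    qed
    then show ?thesis
      unfolding follower_best_reply_def is_arg_max_def by (auto simp: R_def not_less)
  qed
  have u0: "u0_star a b c0 c1 \<ge> 0"
    using b c i unfolding u0_star_def by simp
  have "u1_star a b c0 c1 = r (u0_star a b c0 c1)"
    using b unfolding r_def u0_star_def u1_star_def by (simp add: field_simps)
  moreover have "u1_star a b c0 c1 \<ge> 0"
    using b i unfolding u1_star_def by simp
  ultimately have u1: "u1_star a b c0 c1 = R (u0_star a b c0 c1)"
    unfolding R_def by simp
  have L: "J0 a b c0 v (R v) \<le> J0 a b c0 (u0_star a b c0 c1) (R (u0_star a b c0 c1))"
    if v: "v \<ge> 0" for v
  proof -
    have e: "J0 a b c0 (u0_star a b c0 c1) (R (u0_star a b c0 c1)) = (a + c1 - 2 * c0)\<^sup>2 / (8 * b)"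
      using first_payoffs(1)[OF b, of a c0 c1] unfolding first_J0_star_def u1 .
    show ?thesis
    proof (cases "r v \<ge> 0")
      case True
      then have "J0 a b c0 v (R v) = v * (a - b * r v - b * v - c0)"
        by (simp add: R_def J0_def algebra_simps)
      also have "\<dots> = v * (a + c1 - 2 * c0 - b * v) / 2"
        unfolding br by (simp add: field_simps)
      also have "\<dots> = (a + c1 - 2 * c0)\<^sup>2 / (8 * b) - (a + c1 - 2 * c0 - 2 * (b * v))\<^sup>2 / (8 * b)"
        using b by (simp add: field_simps power2_eq_square)
      also have "\<dots> \<le> (a + c1 - 2 * c0)\<^sup>2 / (8 * b)"
        using b by simp
      finally show ?thesis by (simp add: e)
    next
      case False
      then have bv: "b * v > a - c1"
        using b by (simp add: r_def field_simps)
      from False have "J0 a b c0 v (R v) = v * (a - b * v - c0)"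
        by (simp add: R_def J0_def)
      also have "\<dots> = (b * v) * (a - c0 - b * v) / b"
        using b by simp
      also have "\<dots> \<le> (a - c1) * (c1 - c0) / b"
      proof -
        have "(b * v) * (a - c0 - b * v) - (a - c1) * (c1 - c0)
            = (b * v - (a - c1)) * (c1 - c0 - b * v)"
          by (simp add: algebra_simps)
        moreover have "(b * v - (a - c1)) * (c1 - c0 - b * v) \<le> 0"
          using bv c i by (intro mult_nonneg_nonpos) linarith+
        ultimately show ?thesis
          using b by (intro divide_right_mono) linarith+
      qed
      also have "\<dots> = (8 * (a - c1) * (c1 - c0)) / (8 * b)"
        using b by (simp add: field_simps)
      also have "\<dots> \<le> (a + c1 - 2 * c0)\<^sup>2 / (8 * b)"
      proof -
        have "(a + c1 - 2 * c0)\<^sup>2 - 8 * (a - c1) * (c1 - c0) = (a + 2 * c0 - 3 * c1)\<^sup>2"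
          by (simp add: algebra_simps power2_eq_square)
        then have "8 * (a - c1) * (c1 - c0) \<le> (a + c1 - 2 * c0)\<^sup>2"
          by (smt (verit) zero_le_power2)
        then show ?thesis
          using b by (intro divide_right_mono) auto
      qed
      finally show ?thesis by (simp add: e)
    qed
  qed
  show ?thesis
    unfolding stackelberg_equilibrium_def
    by (rule exI[of _ R]) (use F u0 u1 L in \<open>auto simp: is_arg_max_def not_less\<close>)
qed

end

theory Submission
  imports Defs
begin

text \<open>Write \<open>x = k \<Delta>J\<^sub>0(1)\<close> and let \<open>p = N - m + 1\<close> be the number of games from the \<open>m\<close>-th on.
  Both payoffs in a game carry the factor \<open>\<rho>\<close>, so \<open>\<Delta>J\<^sub>0(n)\<close> is \<open>\<rho>(n) \<Delta>J\<^sub>0(1)\<close>. The recursion for \<open>\<rho>\<close>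
  therefore multiplies it by \<open>1 - x\<close> in each of these games, and \<open>\<rho>\<close> is geometric
  (\<open>rho_power\<close>). Before discounting, a defection pays \<open>9/8\<close> of the equilibrium payoff. Hence the
  total of the leader is
    \<open>J\<^sub>0\<^sup>*(1) ((m - 1) + 9/8 ((1-x) + (1-x)^2 + \<dots> + (1-x)^p))\<close>,
  which is at most \<open>N J\<^sub>0\<^sup>*(1)\<close> exactly when the geometric sum is at most \<open>8p/9\<close>. That sum is
  smaller than \<open>(1 - (1-x)^p) / x\<close>, so the condition \<open>(1-x)^p \<ge> 1 - (8/9) x p\<close> suffices
  (\<open>geometric_sum_le\<close>, \<open>discounted_total_le\<close>).

  It remains to meet that condition with some \<open>0 < x < 1\<close>. To first order in \<open>x\<close> the left-hand side
  is \<open>1 - x p\<close>, so the condition fails for small \<open>x\<close>: the punishment must not be too mild. The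
  choice \<open>x = 9/(8p)\<close> makes the right-hand side vanish, and \<open>x < 1\<close> because \<open>m < N\<close> gives \<open>p \<ge> 2\<close>.\<close>

text \<open>Truncated subtraction makes the exponent \<open>0\<close> before the \<open>m\<close>-th game, which includes the value
  \<open>\<rho>(0) = 1\<close> when \<open>m = 1\<close>.\<close>

lemma rho_power:
  assumes "1 \<le> m"
  shows "rho a b c0 c1 k m n = (1 - k * first_dJ0 a b c0 c1) ^ (Suc n - m)"
proof (induction n)
  case 0
  then show ?case using assms by simp
next
  case (Suc n)
  then show ?case
    by (auto simp: first_dJ0_def Suc_diff_le algebra_simps)
qed

lemma first_J0_hat_eq:
  assumes "b > 0"
  shows "first_J0_hat a b c0 c1 = 9 / 8 * first_J0_star a b c0 c1"
  by (simp add: first_payoffs[OF assms])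

lemma J0_tilde_eq:
  assumes "1 \<le> m"
  shows "J0_tilde a b c0 c1 k m n =
    (if n < m then first_J0_star a b c0 c1
     else (1 - k * first_dJ0 a b c0 c1) ^ (Suc n - m) * first_J0_hat a b c0 c1)"
proof -
  have "- b * u\<^sup>2 + (a - b * w - c0) * u = J0 a b c0 u w" for u w
    by (simp add: J0_def algebra_simps power2_eq_square)
  then show ?thesis
    by (simp add: J0_tilde_def u0_played_def rho_power[OF assms] first_J0_star_def first_J0_hat_def)
qed

lemma sum_J0_tilde:
  assumes "b > 0" "1 \<le> m" "m \<le> N"
  shows "(\<Sum>n = 1..N. J0_tilde a b c0 c1 k m n) =
    first_J0_star a b c0 c1 *
      (real (m - 1) + 9 / 8 * (\<Sum>j<N - m + 1. (1 - k * first_dJ0 a b c0 c1) ^ Suc j))"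
proof -
  let ?q = "1 - k * first_dJ0 a b c0 c1"
  have "{1..N} = {1..<m} \<union> {m..N}"
    using assms by auto
  then have "(\<Sum>n = 1..N. J0_tilde a b c0 c1 k m n) =
      (\<Sum>n = 1..<m. J0_tilde a b c0 c1 k m n) + (\<Sum>n = m..N. J0_tilde a b c0 c1 k m n)"
    by (simp add: sum.union_disjoint ivl_disj_int)
  also have "(\<Sum>n = 1..<m. J0_tilde a b c0 c1 k m n) = real (m - 1) * first_J0_star a b c0 c1"
    by (simp add: J0_tilde_eq[OF assms(2)])
  also have "(\<Sum>n = m..N. J0_tilde a b c0 c1 k m n) =
      (\<Sum>j<N - m + 1. ?q ^ Suc j * first_J0_hat a b c0 c1)"
    by (rule sum.reindex_bij_witness[of _ "\<lambda>j. j + m" "\<lambda>n. n - m"])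
       (use assms in \<open>auto simp: J0_tilde_eq Suc_diff_le\<close>)
  also have "\<dots> = 9 / 8 * first_J0_star a b c0 c1 * (\<Sum>j<N - m + 1. ?q ^ Suc j)"
    unfolding first_J0_hat_eq[OF assms(1)] sum_distrib_left by (rule sum.cong) auto
  finally show ?thesis
    by (simp only: algebra_simps)
qed

text \<open>Raising each term to the next lower exponent turns the sum into \<open>(1 - (1-x)^p) / x\<close>, where the
  power occurs just as in the condition.\<close>

lemma geometric_sum_le:
  fixes x c :: real
  assumes "0 < x" "x \<le> 1" and "(1 - x) ^ p \<ge> 1 - c * x * real p"
  shows "(\<Sum>j<p. (1 - x) ^ Suc j) \<le> c * real p"
proof -
  have "(\<Sum>j<p. (1 - x) ^ Suc j) \<le> (\<Sum>j<p. (1 - x) ^ j)"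
    using assms by (intro sum_mono power_decreasing) auto
  also have "\<dots> = (1 - (1 - x) ^ p) / x"
    using assms by (simp add: sum_gp_strict)
  also have "\<dots> \<le> c * real p"
    using assms by (simp add: field_simps)
  finally show ?thesis .
qed

text \<open>The bound \<open>8/9\<close> is the reciprocal of the gain factor \<open>9/8\<close>, so the \<open>p\<close> discounted defection
  games are worth at most \<open>p\<close> equilibrium games.\<close>

lemma discounted_total_le:
  assumes "b > 0" "1 \<le> m" "m \<le> N"
    and "0 < k * first_dJ0 a b c0 c1" "k * first_dJ0 a b c0 c1 \<le> 1"
    and "(1 - k * first_dJ0 a b c0 c1) ^ (N - m + 1)
      \<ge> 1 - 8 / 9 * (k * first_dJ0 a b c0 c1) * real (N - m + 1)"
  shows "(\<Sum>n = 1..N. J0_tilde a b c0 c1 k m n) \<le> real N * first_J0_star a b c0 c1"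
proof -
  let ?S = "\<Sum>j<N - m + 1. (1 - k * first_dJ0 a b c0 c1) ^ Suc j"
  have "?S \<le> 8 / 9 * real (N - m + 1)"
    by (rule geometric_sum_le) (use assms in auto)
  then have "real (m - 1) + 9 / 8 * ?S \<le> real (m - 1) + real (N - m + 1)"
    by simp
  also have "\<dots> = real N"
    using assms by simp
  finally have "real (m - 1) + 9 / 8 * ?S \<le> real N" .
  moreover have "0 \<le> first_J0_star a b c0 c1"
    using assms by (simp add: first_payoffs)
  ultimately show ?thesis
    unfolding sum_J0_tilde[OF assms(1-3)]
    by (metis mult_left_mono mult.commute)
qed

theorem theorem1p1:
  fixes a b c0 c1 :: real and U0 U1 :: "real set" and N m :: nat
  assumes "a > 0" and "b > 0" and "c0 \<le> c1"
    and "stackelberg_equilibrium a b c0 c1 U0 U1 (u0_star a b c0 c1) (u1_star a b c0 c1)"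
    and "leader_best_reply a b c0 U0 (u1_star a b c0 c1) (u0_hat a b c0 c1)"
    and "first_dJ0 a b c0 c1 > 0"
    and "1 \<le> m" and "m < N"
  shows "\<exists>k. 0 < k \<and> k < 1 / first_dJ0 a b c0 c1 \<and>
           (1 - k * first_dJ0 a b c0 c1) ^ (N - m + 1)
             \<ge> 1 - 8 / 9 * k * first_dJ0 a b c0 c1 * real (N - m + 1) \<and>
           (\<Sum>n = 1..N. J0_tilde a b c0 c1 k m n) \<le> real N * first_J0_star a b c0 c1"
proof -
  define D where "D = first_dJ0 a b c0 c1"
  define p where "p = N - m + 1"
  \<comment> \<open>this makes the lower bound for \<open>(1-x)^p\<close> equal to \<open>0\<close>\<close>
  define x where "x = 9 / (8 * real p)"
  have D: "D > 0" and p: "p \<ge> 2"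
    using assms by (auto simp: D_def p_def)
  have x: "0 < x" "x < 1" "8 / 9 * x * real p = 1"
    using p by (auto simp: x_def field_simps)
  have xD: "x / D * D = x"
    using D by simp
  have cond: "(1 - x) ^ p \<ge> 1 - 8 / 9 * x * real p"
    using x by simp
  have total: "(\<Sum>n = 1..N. J0_tilde a b c0 c1 (x / D) m n) \<le> real N * first_J0_star a b c0 c1"
    by (rule discounted_total_le)
       (use assms x cond in \<open>simp_all only: D_def[symmetric] p_def[symmetric] xD less_imp_le\<close>)
  show ?thesis
    unfolding D_def[symmetric] p_def[symmetric]
  proof (intro exI[of _ "x / D"] conjI total)
    show "0 < x / D" "x / D < 1 / D"
      using x D by (simp_all add: divide_strict_right_mono)
    show "1 - 8 / 9 * (x / D) * D * real p \<le> (1 - x / D * D) ^ p"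
      using cond D by simp
  qed
qed

end
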